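(* Let $q$ be a prime power. The smallest degree of a nonsingular plane curve over $\mathbb{F}_q$ which contains $\mathbb{P}^2(\mathbb{F}_q)$ is $q+2$. That is, every nonsingular plane curve defined over $\mathbb{F}_q$ that contains all $\mathbb{F}_q$-rational points of $\mathbb{P}^2$ has degree at least $q+2$, and there exists such a curve of degree exactly $q+2$.
   Context: A plane curve over $\mathbb{F}_q$ is the zero locus in $\mathbb{P}^2$ of a nonzero homogeneous polynomial over $\mathbb{F}_q$ of positive degree. It is called nonsingular if it is nonsingular at every $K$-point, where $K$ is the algebraic closure of $\mathbb{F}_q$ (not only at the $\mathbb{F}_q$-points). $\mathbb{P}^2(\mathbb{F}_q)$ is the set of $\mathbb{F}_q$-rational points of $\mathbb{P}^2$. *)

theory Defs
  imports
    "HOL-Analysis.Cartesian_Space"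
    "HOL-Library.Poly_Mapping"
    "HOL-Algebra.Algebraic_Closure_Type"
    "HOL-Number_Theory.Prime_Powers"
begin

section \<open>Polynomials in finitely many variables\<close>

text \<open>A polynomial is a finitely supported map from exponent vectors to coefficients; its ring
  structure is the convolution product of \<^theory>\<open>HOL-Library.Poly_Mapping\<close>.\<close>

type_synonym ('n, 'a) mpol = "('n \<Rightarrow>\<^sub>0 nat) \<Rightarrow>\<^sub>0 'a"

definition mpol_eval :: "('n::finite, 'a::comm_semiring_1) mpol \<Rightarrow> 'a ^ 'n \<Rightarrow> 'a" where
  "mpol_eval F v =
     (\<Sum>m\<in>Poly_Mapping.keys F.
        Poly_Mapping.lookup F m * (\<Prod>i\<in>UNIV. (v $ i) ^ Poly_Mapping.lookup m i))"

text \<open>The subtraction of exponents truncates only when the exponent of \<open>X\<^sub>i\<close> is \<open>0\<close>, in which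
  case the coefficient is \<open>0\<close> as well.\<close>

definition mpol_pderiv ::
  "'n \<Rightarrow> ('n, 'a::comm_semiring_1) mpol \<Rightarrow> ('n, 'a) mpol" where
  "mpol_pderiv i F =
     (\<Sum>m\<in>Poly_Mapping.keys F.
        Poly_Mapping.single (m - Poly_Mapping.single i 1)
          (of_nat (Poly_Mapping.lookup m i) * Poly_Mapping.lookup F m))"

definition homogeneous_of_degree :: "nat \<Rightarrow> ('n::finite, 'a::zero) mpol \<Rightarrow> bool" where
  "homogeneous_of_degree d F \<longleftrightarrow>
     (\<forall>m\<in>Poly_Mapping.keys F. (\<Sum>i\<in>UNIV. Poly_Mapping.lookup m i) = d)"

definition mpol_to_ac :: "('n, 'a::field) mpol \<Rightarrow> ('n, 'a alg_closure) mpol" where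
  "mpol_to_ac F = Poly_Mapping.map to_ac F"


section \<open>The projective plane\<close>

text \<open>A point of the projective plane is the set of all its homogeneous coordinate vectors.\<close>

definition proj_point :: "'k::field ^ 3 \<Rightarrow> ('k ^ 3) set" where
  "proj_point v = {c *s v | c. c \<noteq> 0}"

definition proj_plane :: "('k::field ^ 3) set set" where
  "proj_plane = {proj_point v | v. v \<noteq> 0}"

text \<open>The rational points of the plane over the algebraic closure: those having homogeneous
  coordinates in the base field.\<close>

definition rational_points :: "('a::field alg_closure ^ 3) set set" where
  "rational_points = {proj_point (\<chi> i. to_ac (v $ i)) | v :: 'a ^ 3. v \<noteq> 0}"


section \<open>Plane curves\<close>

text \<open>As usual, a plane curve over \<open>'a\<close> is given by its equation \<open>F\<close>, and its degree and its
  singular points are those of \<open>F\<close> (so multiple components are singular).\<close>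

definition plane_curve :: "nat \<Rightarrow> (3, 'a::field) mpol \<Rightarrow> bool" where
  "plane_curve d F \<longleftrightarrow> F \<noteq> 0 \<and> d > 0 \<and> homogeneous_of_degree d F"

text \<open>For homogeneous \<open>F\<close>, the vanishing of \<open>F\<close> and of its partial derivatives at a point does
  not depend on the choice of homogeneous coordinates.\<close>

definition zero_locus :: "(3, 'a::field) mpol \<Rightarrow> ('a alg_closure ^ 3) set set" where
  "zero_locus F = {P \<in> proj_plane. \<forall>v\<in>P. mpol_eval (mpol_to_ac F) v = 0}"

text \<open>The characteristic may divide the degree, so the common zeros of the partial derivatives
  need not lie on the curve.\<close>

definition nonsingular :: "(3, 'a::field) mpol \<Rightarrow> bool" where
  "nonsingular F \<longleftrightarrow>
     (\<forall>P\<in>zero_locus F. \<forall>v\<in>P. \<exists>i. mpol_eval (mpol_pderiv i (mpol_to_ac F)) v \<noteq> 0)"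

end

theory Submission
  imports Defs "HOL-Number_Theory.Residues"
begin

text \<open>
  Throughout, \<open>K\<close> is the algebraic closure of the field \<open>k\<close> with \<open>q\<close> elements.

  \<^emph>\<open>Lower bound.\<close> Suppose that a nonsingular form \<open>F\<close> of degree \<open>d \<le> q + 1\<close> vanishes at all
  rational points. The tangent line of the curve at a rational point \<open>P\<close> is itself rational, so it
  meets the curve in its \<open>q + 1\<close> rational points, and twice at \<open>P\<close>: that is \<open>q + 2 > d\<close>
  intersections, so the tangent is contained in the curve (\<open>contains_line_if_tangent\<close>). But a curve
  of degree \<open>d \<ge> 2\<close> that contains a line is singular: on the line only the transversal derivative
  of \<open>F\<close> survives, and it restricts to a binary form of degree \<open>d - 1 \<ge> 1\<close>, which has a zero over
  \<open>K\<close> (\<open>singular_point_if_contains_line\<close>). A form of degree \<open>1\<close> that vanishes at the unit vectors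
  is zero, so \<open>d = 1\<close> is impossible too.

  \<^emph>\<open>Existence.\<close> Let \<open>\<theta>\<close> generate the cubic extension of \<open>k\<close>, identified with \<open>k\<^sup>3\<close>, and let \<open>M\<close>
  be the matrix of multiplication by \<open>\<theta>\<close>. The form \<open>det (M x, x, x\<^sup>q)\<close>, with the \<open>q\<close>-th power
  taken in each coordinate, has degree \<open>q + 2\<close>, and it vanishes at rational \<open>x\<close> because then
  \<open>x = x\<^sup>q\<close>. Over \<open>K\<close> the matrix \<open>M\<close> is diagonalized by three conjugate linear forms \<open>\<xi>\<close>, which
  the \<open>q\<close>-th power permutes cyclically. In these coordinates the curve is
  \<open>A \<xi>\<^sub>1 \<xi>\<^sub>2\<^sup>q\<^sup>+\<^sup>1 + B \<xi>\<^sub>2 \<xi>\<^sub>3\<^sup>q\<^sup>+\<^sup>1 + C \<xi>\<^sub>3 \<xi>\<^sub>1\<^sup>q\<^sup>+\<^sup>1 = 0\<close> with nonzero \<open>A, B, C\<close>, a curve of the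
  shape of Klein's quartic, and its nonsingularity can be read off
  (\<open>cyclic_curve_nonsingular\<close>).
\<close>

no_notation fps_nth (infixl "$" 75)

section \<open>Evaluation, derivatives and scalar extension of polynomials\<close>

abbreviation lookup :: "('a \<Rightarrow>\<^sub>0 'b::zero) \<Rightarrow> 'a \<Rightarrow> 'b"
  where "lookup \<equiv> Poly_Mapping.lookup"
abbreviation keys :: "('a \<Rightarrow>\<^sub>0 'b::zero) \<Rightarrow> 'a set"
  where "keys \<equiv> Poly_Mapping.keys"
abbreviation single :: "'a \<Rightarrow> 'b::zero \<Rightarrow> 'a \<Rightarrow>\<^sub>0 'b"
  where "single \<equiv> Poly_Mapping.single"

lemma mpol_eval_superset:
  assumes "finite S" "keys F \<subseteq> S"
  shows "mpol_eval F v = (\<Sum>m\<in>S. lookup F m * (\<Prod>i\<in>UNIV. (v $ i) ^ lookup m i))"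
  unfolding mpol_eval_def
  by (rule sum.mono_neutral_left) (use assms in \<open>auto simp: in_keys_iff\<close>)

lemma mpol_eval_0 [simp]: "mpol_eval 0 v = 0"
  by (simp add: mpol_eval_def)

lemma mpol_eval_single [simp]:
  "mpol_eval (single m c) v = c * (\<Prod>i\<in>UNIV. (v $ i) ^ lookup m i)"
  by (subst mpol_eval_superset[of "{m}"]) auto

lemma mpol_eval_add: "mpol_eval (F + G) v = mpol_eval F v + mpol_eval G v"
proof -
  have "keys (F + G) \<subseteq> keys F \<union> keys G" by (rule keys_add)
  then show ?thesis
    by (simp add: mpol_eval_superset[of "keys F \<union> keys G"] lookup_add algebra_simps sum.distrib)
qed

lemma mpol_eval_sum: "mpol_eval (sum f A) v = (\<Sum>a\<in>A. mpol_eval (f a) v)"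
  by (induction A rule: infinite_finite_induct) (auto simp: mpol_eval_add)

lemma mpol_pderiv_superset:
  assumes "finite S" "keys F \<subseteq> S"
  shows "mpol_pderiv i F = (\<Sum>m\<in>S. single (m - single i 1) (of_nat (lookup m i) * lookup F m))"
  unfolding mpol_pderiv_def
  by (rule sum.mono_neutral_left) (use assms in \<open>auto simp: in_keys_iff\<close>)

lemma mpol_pderiv_single [simp]:
  "mpol_pderiv i (single m c) = single (m - single i 1) (of_nat (lookup m i) * c)"
  by (subst mpol_pderiv_superset[of "{m}"]) auto

lemma mpol_pderiv_add: "mpol_pderiv i (F + G) = mpol_pderiv i F + mpol_pderiv i G"
proof -
  have "keys (F + G) \<subseteq> keys F \<union> keys G" by (rule keys_add)
  then show ?thesis
    by (simp add: mpol_pderiv_superset[of "keys F \<union> keys G"] lookup_add algebra_simps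
        sum.distrib single_add)
qed

lemma lookup_mpol_to_ac: "lookup (mpol_to_ac F) m = to_ac (lookup F m)"
  by (simp add: mpol_to_ac_def Poly_Mapping.map.rep_eq when_def)

lemma keys_mpol_to_ac [simp]: "keys (mpol_to_ac F) = keys F"
  by (auto simp: in_keys_iff lookup_mpol_to_ac)

lemma mpol_to_ac_single [simp]: "mpol_to_ac (single m c) = single m (to_ac c)"
  by (simp add: mpol_to_ac_def)

lemma mpol_to_ac_add: "mpol_to_ac (F + G) = mpol_to_ac F + mpol_to_ac G"
  by (rule poly_mapping_eqI) (simp add: lookup_mpol_to_ac lookup_add)

lemma mpol_to_ac_0 [simp]: "mpol_to_ac 0 = 0"
  by (rule poly_mapping_eqI) (simp add: lookup_mpol_to_ac)

lemma mpol_to_ac_sum: "mpol_to_ac (sum f A) = (\<Sum>a\<in>A. mpol_to_ac (f a))"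
  by (induction A rule: infinite_finite_induct) (auto simp: mpol_to_ac_add)

lemma mpol_pderiv_to_ac: "mpol_pderiv i (mpol_to_ac F) = mpol_to_ac (mpol_pderiv i F)"
  by (simp add: mpol_pderiv_def mpol_to_ac_sum lookup_mpol_to_ac)

lemma mpol_eval_to_ac:
  "mpol_eval (mpol_to_ac F) (\<chi> i. to_ac (v $ i)) = to_ac (mpol_eval F v)"
  by (simp add: mpol_eval_def to_ac_sum to_ac_prod lookup_mpol_to_ac)

lemma mpol_eval_scale:
  assumes "homogeneous_of_degree d F"
  shows "mpol_eval F (c *s v) = c ^ d * mpol_eval F v"
proof -
  have "(\<Prod>i\<in>UNIV. ((c *s v) $ i) ^ lookup m i) = c ^ d * (\<Prod>i\<in>UNIV. (v $ i) ^ lookup m i)"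
    if "m \<in> keys F" for m
    using assms that
    by (simp add: power_mult_distrib prod.distrib homogeneous_of_degree_def flip: power_sum)
  then show ?thesis
    by (simp add: mpol_eval_def sum_distrib_left mult_ac)
qed

lemma homogeneous_of_degree_mpol_pderiv:
  assumes "homogeneous_of_degree d F"
  shows "homogeneous_of_degree (d - 1) (mpol_pderiv i F)"
  unfolding homogeneous_of_degree_def
proof
  fix n assume n: "n \<in> keys (mpol_pderiv i F)"
  have "keys (mpol_pderiv i F) \<subseteq>
      (\<Union>m\<in>keys F. keys (single (m - single i 1) (of_nat (lookup m i) * lookup F m)))"
    unfolding mpol_pderiv_def by (rule keys_sum)
  then obtain m where m: "m \<in> keys F" "lookup m i > 0" "n = m - single i 1"
    using n by (fastforce split: if_splits)
  have "(\<Sum>j\<in>UNIV. lookup m j) = d"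
    using assms m by (simp add: homogeneous_of_degree_def)
  moreover have "(\<Sum>j\<in>UNIV. lookup m j) = lookup m i + (\<Sum>j\<in>UNIV-{i}. lookup m j)"
    by (rule sum.remove) auto
  moreover have "(\<Sum>j\<in>UNIV. lookup n j) = lookup n i + (\<Sum>j\<in>UNIV-{i}. lookup n j)"
    by (rule sum.remove) auto
  moreover have "(\<Sum>j\<in>UNIV-{i}. lookup n j) = (\<Sum>j\<in>UNIV-{i}. lookup m j)"
    by (rule sum.cong) (auto simp: m lookup_minus lookup_single when_def)
  moreover have "lookup n i = lookup m i - 1"
    by (simp add: m lookup_minus)
  ultimately show "(\<Sum>j\<in>UNIV. lookup n j) = d - 1"
    using m(2) by linarith
qed


section \<open>Restriction of a polynomial to a line\<close>

text \<open>The restriction of \<open>F\<close> to the line through \<open>v\<close> in direction \<open>h\<close>. Having it as a univariate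
  polynomial makes multiplicities of intersection with the line available as multiplicities of
  roots, and directional derivatives as values of the ordinary derivative.\<close>

definition mpol_line :: "('n::finite, 'a::comm_ring_1) mpol \<Rightarrow> 'a ^ 'n \<Rightarrow> 'a ^ 'n \<Rightarrow> 'a poly" where
  "mpol_line F v h =
     (\<Sum>m\<in>keys F. smult (lookup F m) (\<Prod>i\<in>UNIV. [:v $ i, h $ i:] ^ lookup m i))"

lemma poly_mpol_line: "poly (mpol_line F v h) t = mpol_eval F (v + t *s h)"
  by (simp add: mpol_line_def mpol_eval_def poly_sum poly_prod)

lemma pderiv_sum: "pderiv (sum f A) = (\<Sum>a\<in>A. pderiv (f a))"
  by (induction A rule: infinite_finite_induct) (auto simp: pderiv_add)

lemma poly_pderiv_mpol_line:
  fixes F :: "('n::finite, 'a::idom) mpol"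
  shows "poly (pderiv (mpol_line F v h)) 0 = (\<Sum>i\<in>UNIV. h $ i * mpol_eval (mpol_pderiv i F) v)"
proof -
  have 1: "(\<Prod>j\<in>UNIV. v $ j ^ lookup (m - single i 1) j) =
      v $ i ^ (lookup m i - 1) * (\<Prod>j\<in>UNIV-{i}. v $ j ^ lookup m j)" for m i
  proof -
    have "(\<Prod>j\<in>UNIV-{i}. v $ j ^ lookup (m - single i 1) j) = (\<Prod>j\<in>UNIV-{i}. v $ j ^ lookup m j)"
      by (rule prod.cong) (auto simp: lookup_minus lookup_single when_def)
    then show ?thesis
      by (subst prod.remove[of _ i]) (auto simp: lookup_minus)
  qed
  have "poly (pderiv (\<Prod>i\<in>UNIV. [:v $ i, h $ i:] ^ lookup m i)) 0 =
      (\<Sum>i\<in>UNIV. h $ i * of_nat (lookup m i) * (\<Prod>j\<in>UNIV. v $ j ^ lookup (m - single i 1) j))" for m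
    unfolding 1
    by (simp add: pderiv_prod poly_sum poly_prod pderiv_power pderiv_pCons mult_ac)
  then have "poly (pderiv (mpol_line F v h)) 0 = (\<Sum>m\<in>keys F. \<Sum>i\<in>UNIV. lookup F m *
      (h $ i * of_nat (lookup m i) * (\<Prod>j\<in>UNIV. v $ j ^ lookup (m - single i 1) j)))"
    by (simp add: mpol_line_def pderiv_sum poly_sum pderiv_smult sum_distrib_left)
  also have "\<dots> = (\<Sum>i\<in>UNIV. h $ i * mpol_eval (mpol_pderiv i F) v)"
    by (subst sum.swap) (simp add: mpol_pderiv_def mpol_eval_sum sum_distrib_left mult_ac)
  finally show ?thesis .
qed

lemma coeff_mult_at_degree_bounds:
  fixes p q :: "'a::comm_semiring_0 poly"
  assumes "degree p \<le> a" "degree q \<le> b"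
  shows "coeff (p * q) (a + b) = coeff p a * coeff q b"
proof -
  have "coeff p i * coeff q (a + b - i) = 0" if "i \<noteq> a" "i \<le> a + b" for i
    using assms that by (cases "i < a") (auto simp: coeff_eq_0)
  then have "(\<Sum>i\<le>a + b. coeff p i * coeff q (a + b - i)) = (\<Sum>i\<in>{a}. coeff p i * coeff q (a + b - i))"
    by (intro sum.mono_neutral_right) auto
  then show ?thesis by (simp add: coeff_mult)
qed

lemma degree_coeff_linear_power:
  fixes a b :: "'a::comm_ring_1"
  shows "degree ([:a, b:] ^ n) \<le> n \<and> coeff ([:a, b:] ^ n) n = b ^ n"
proof (induction n)
  case (Suc n)
  have "degree [:a, b:] \<le> 1" by simp
  then have "degree ([:a, b:] * [:a, b:] ^ n) \<le> 1 + n"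
    using Suc degree_mult_le[of "[:a, b:]" "[:a, b:] ^ n"] by linarith
  moreover have "coeff ([:a, b:] * [:a, b:] ^ n) (1 + n) = b * b ^ n"
    using Suc by (subst coeff_mult_at_degree_bounds) auto
  ultimately show ?case by simp
qed simp

lemma degree_coeff_prod_linear_power:
  fixes a b :: "'n \<Rightarrow> 'a::comm_ring_1"
  assumes "finite A"
  shows "degree (\<Prod>i\<in>A. [:a i, b i:] ^ k i) \<le> sum k A \<and>
    coeff (\<Prod>i\<in>A. [:a i, b i:] ^ k i) (sum k A) = (\<Prod>i\<in>A. b i ^ k i)"
  using assms
proof induction
  case (insert j A)
  note * = degree_coeff_linear_power[of "a j" "b j" "k j"]
  show ?case
    using insert * coeff_mult_at_degree_bounds[of "[:a j, b j:] ^ k j" "k j"]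
      degree_mult_le[of "[:a j, b j:] ^ k j" "\<Prod>i\<in>A. [:a i, b i:] ^ k i"] by auto
qed simp

text \<open>The coefficient in degree \<open>d\<close> is the value of \<open>F\<close> at the point at infinity of the line. If \<open>F\<close>
  vanishes there, the degree drops, which accounts for that intersection point.\<close>

lemma degree_coeff_mpol_line:
  fixes F :: "('n::finite, 'a::comm_ring_1) mpol"
  assumes "homogeneous_of_degree d F"
  shows degree_mpol_line: "degree (mpol_line F v h) \<le> d"
    and coeff_mpol_line: "coeff (mpol_line F v h) d = mpol_eval F h"
proof -
  have *: "degree (\<Prod>i\<in>UNIV. [:v $ i, h $ i:] ^ lookup m i) \<le> d \<and>
      coeff (\<Prod>i\<in>UNIV. [:v $ i, h $ i:] ^ lookup m i) d = (\<Prod>i\<in>UNIV. h $ i ^ lookup m i)"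
    if "m \<in> keys F" for m
    using degree_coeff_prod_linear_power[of UNIV "\<lambda>i. v $ i" "\<lambda>i. h $ i" "lookup m"] that assms
    by (simp add: homogeneous_of_degree_def)
  show "degree (mpol_line F v h) \<le> d"
    unfolding mpol_line_def using * by (intro degree_sum_le) (auto intro: order.trans[OF degree_smult_le])
  show "coeff (mpol_line F v h) d = mpol_eval F h"
    using * by (simp add: mpol_line_def mpol_eval_def coeff_sum)
qed

text \<open>If all values of \<open>p\<close> are zero, then \<open>p + 1\<close> has no root and so is constant.\<close>

lemma alg_closed_poly_eq_0:
  fixes p :: "'a::alg_closed_field poly"
  assumes "\<And>t. poly p t = 0"
  shows "p = 0"
proof -
  have "poly (p + 1) t \<noteq> 0" for t by (simp add: assms)
  then have "degree (p + 1) = 0"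
    using alg_closed_imp_poly_has_root[of "p + 1"] by blast
  then have "degree p = 0" by (metis add_diff_cancel_right' degree_1 degree_diff_le le_zero_eq)
  then show ?thesis using assms[of 0] by (metis degree_eq_zeroE poly_pCons mult_zero_left add.right_neutral pCons_0_0)
qed

lemma directional_derivative_eq_0:
  fixes F :: "('n::finite, 'a::alg_closed_field) mpol"
  assumes "\<And>t. mpol_eval F (v + t *s h) = 0"
  shows "(\<Sum>i\<in>UNIV. h $ i * mpol_eval (mpol_pderiv i F) v) = 0"
proof -
  have "mpol_line F v h = 0"
    by (rule alg_closed_poly_eq_0) (simp add: poly_mpol_line assms)
  then show ?thesis
    by (simp flip: poly_pderiv_mpol_line)
qed

section \<open>The lower bound\<close>

lemma nonsingularD:
  fixes F :: "(3, 'a::field) mpol"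
  assumes "nonsingular F" "homogeneous_of_degree d F" "x \<noteq> 0" "mpol_eval (mpol_to_ac F) x = 0"
  shows "\<exists>i. mpol_eval (mpol_pderiv i (mpol_to_ac F)) x \<noteq> 0"
proof -
  have hom: "homogeneous_of_degree d (mpol_to_ac F)"
    using assms(2) by (simp add: homogeneous_of_degree_def)
  have "proj_point x \<in> zero_locus F"
    using assms(3,4) by (auto simp: zero_locus_def proj_plane_def proj_point_def mpol_eval_scale[OF hom])
  moreover have "x \<in> proj_point x"
    unfolding proj_point_def by (rule CollectI, rule exI[of _ 1]) simp
  ultimately show ?thesis
    using assms(1) unfolding nonsingular_def by blast
qed

lemma eval_rational_point_eq_0:
  fixes F :: "(3, 'a::field) mpol"
  assumes "rational_points \<subseteq> zero_locus F" "v \<noteq> 0"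
  shows "mpol_eval (mpol_to_ac F) (\<chi> i. to_ac (v $ i)) = 0"
proof -
  let ?v = "(\<chi> i. to_ac (v $ i)) :: 'a alg_closure ^ 3"
  have "proj_point ?v \<in> zero_locus F"
    using assms unfolding rational_points_def by blast
  moreover have "?v \<in> proj_point ?v"
    unfolding proj_point_def by (rule CollectI, rule exI[of _ 1]) simp
  ultimately show ?thesis unfolding zero_locus_def by blast
qed

text \<open>Counted with multiplicity, the number of roots of \<open>p\<close> exceeds its degree.\<close>

lemma poly_eq_0_if_double_root:
  fixes p :: "'a::field poly"
  assumes "finite R" "0 \<in> R" "\<And>t. t \<in> R \<Longrightarrow> poly p t = 0" "poly (pderiv p) 0 = 0"
    and "degree p \<le> card R"
  shows "p = 0"
proof (rule ccontr)
  assume "p \<noteq> 0"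
  obtain a h where h: "p = pCons a h" by (cases p)
  have "a = 0" using assms(3)[of 0] assms(2) h by simp
  with \<open>p \<noteq> 0\<close> h have "h \<noteq> 0" by auto
  have "poly h 0 = 0" using assms(4) by (simp add: h pderiv_pCons)
  moreover have "poly h t = 0" if "t \<in> R" "t \<noteq> 0" for t
    using assms(3)[OF that(1)] that(2) by (simp add: h \<open>a = 0\<close>)
  ultimately have "R \<subseteq> {t. poly h t = 0}" by auto
  then have "card R \<le> card {t. poly h t = 0}"
    using poly_roots_finite[OF \<open>h \<noteq> 0\<close>] by (intro card_mono)
  also have "\<dots> \<le> degree h" by (rule card_poly_roots_bound) fact
  finally show False using assms(5) \<open>h \<noteq> 0\<close> by (simp add: h)
qed

lemma sum_UNIV_3_distinct:
  fixes f :: "3 \<Rightarrow> 'b::comm_monoid_add"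
  assumes "UNIV = {i, j, k :: 3}" "i \<noteq> j" "i \<noteq> k" "j \<noteq> k"
  shows "sum f UNIV = f i + f j + f k"
  unfolding assms(1) using assms(2-4) by (simp add: add.assoc)

text \<open>At every point of the line the derivatives in the directions \<open>u\<close> and \<open>w\<close> vanish. Since the
  \<open>(j, k)\<close>-minor of \<open>u, w\<close> is nonzero, a gradient orthogonal to both is zero as soon as its \<open>i\<close>-th
  entry is. So it suffices to find a zero of the single partial derivative \<open>\<partial>\<^sub>i G\<close> on the line.\<close>

lemma singular_point_if_contains_line:
  fixes G :: "(3, 'k::alg_closed_field) mpol"
  assumes hom: "homogeneous_of_degree d G" and "d \<ge> 2"
    and line: "\<And>s t. mpol_eval G (s *s u + t *s w) = 0"
    and ijk: "UNIV = {i, j, k :: 3}" "i \<noteq> j" "i \<noteq> k" "j \<noteq> k"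
    and minor: "u $ j * w $ k \<noteq> u $ k * w $ j"
  shows "\<exists>x\<noteq>0. mpol_eval G x = 0 \<and> (\<forall>l. mpol_eval (mpol_pderiv l G) x = 0)"
proof -
  let ?g = "\<lambda>l. mpol_eval (mpol_pderiv l G)"
  have hom': "homogeneous_of_degree (d - 1) (mpol_pderiv i G)"
    using hom by (rule homogeneous_of_degree_mpol_pderiv)
  have "\<exists>s t. (s \<noteq> 0 \<or> t \<noteq> 0) \<and> ?g i (s *s u + t *s w) = 0"
    \<comment> \<open>either the point at infinity \<open>w\<close> is a zero, or the restriction has full degree \<open>d - 1 \<ge> 1\<close>\<close>
  proof (cases "?g i w = 0")
    case True
    then show ?thesis by (intro exI[of _ 0] exI[of _ 1]) simp
  next
    case False
    then have "coeff (mpol_line (mpol_pderiv i G) u w) (d - 1) \<noteq> 0"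
      unfolding coeff_mpol_line[OF hom'] .
    then have "degree (mpol_line (mpol_pderiv i G) u w) \<ge> d - 1"
      by (rule le_degree)
    then obtain t where "poly (mpol_line (mpol_pderiv i G) u w) t = 0"
      using \<open>d \<ge> 2\<close> alg_closed_imp_poly_has_root by (metis One_nat_def Suc_1 diff_is_0_eq le_zero_eq not_less_eq_eq not_gr0)
    then show ?thesis by (intro exI[of _ 1] exI[of _ t]) (simp add: poly_mpol_line)
  qed
  then obtain s t where st: "s \<noteq> 0 \<or> t \<noteq> 0" and gi: "?g i (s *s u + t *s w) = 0" by blast
  define x where "x = s *s u + t *s w"
  have "x \<noteq> 0"
  proof
    assume "x = 0"
    then have "s * u $ j + t * w $ j = 0" "s * u $ k + t * w $ k = 0"
      by (auto simp: x_def vec_eq_iff)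
    moreover have "s * (u $ j * w $ k - u $ k * w $ j) =
        w $ k * (s * u $ j + t * w $ j) - w $ j * (s * u $ k + t * w $ k)"
      "t * (u $ j * w $ k - u $ k * w $ j) =
        u $ j * (s * u $ k + t * w $ k) - u $ k * (s * u $ j + t * w $ j)"
      by (simp_all add: algebra_simps)
    ultimately have "s * (u $ j * w $ k - u $ k * w $ j) = 0" "t * (u $ j * w $ k - u $ k * w $ j) = 0"
      by simp_all
    then show False using st minor by simp
  qed
  have "x + r *s u = (s + r) *s u + t *s w" "x + r *s w = s *s u + (t + r) *s w" for r
    by (simp_all add: x_def vec_eq_iff algebra_simps)
  then have "(\<Sum>l\<in>UNIV. u $ l * ?g l x) = 0" "(\<Sum>l\<in>UNIV. w $ l * ?g l x) = 0"
    by (intro directional_derivative_eq_0; simp add: line)+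
  then have "u $ j * ?g j x + u $ k * ?g k x = 0" "w $ j * ?g j x + w $ k * ?g k x = 0"
    using gi by (simp_all add: sum_UNIV_3_distinct[OF ijk] x_def)
  moreover have "?g j x * (u $ j * w $ k - u $ k * w $ j) =
      w $ k * (u $ j * ?g j x + u $ k * ?g k x) - u $ k * (w $ j * ?g j x + w $ k * ?g k x)"
    "?g k x * (u $ j * w $ k - u $ k * w $ j) =
      u $ j * (w $ j * ?g j x + w $ k * ?g k x) - w $ j * (u $ j * ?g j x + u $ k * ?g k x)"
    by (simp_all add: algebra_simps)
  ultimately have "?g j x * (u $ j * w $ k - u $ k * w $ j) = 0"
      "?g k x * (u $ j * w $ k - u $ k * w $ j) = 0"
    by simp_all
  then have "?g j x = 0" "?g k x = 0" using minor by auto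
  then have "\<forall>l. ?g l x = 0"
    using gi ijk(1) unfolding x_def by (metis UNIV_I empty_iff insert_iff)
  moreover have "mpol_eval G x = 0" unfolding x_def by (rule line)
  ultimately show ?thesis using \<open>x \<noteq> 0\<close> by blast
qed

text \<open>The restriction of \<open>G\<close> to the tangent has the \<open>q\<close> elements of the base field as roots, the one
  at \<open>0\<close> being double. The remaining rational point \<open>w\<close> lowers its degree to at most
  \<open>d - 1 \<le> q\<close>. Hence the restriction is zero.\<close>

lemma contains_line_if_tangent:
  fixes F :: "(3, 'a::{field,finite}) mpol"
  defines "G \<equiv> mpol_to_ac F"
  assumes hom: "homogeneous_of_degree d F" and d: "0 < d" "d \<le> CARD('a) + 1"
    and rat: "rational_points \<subseteq> zero_locus F"
    and u: "u = (\<chi> i. to_ac (u0 $ i))" and w: "w = (\<chi> i. to_ac (w0 $ i))"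
    and indep: "\<And>t. u0 + t *s w0 \<noteq> 0" "w0 \<noteq> 0"
    and tangent: "(\<Sum>l\<in>UNIV. w $ l * mpol_eval (mpol_pderiv l G) u) = 0"
  shows "mpol_eval G (s *s u + t *s w) = 0"
proof -
  have homG: "homogeneous_of_degree d G"
    using hom by (simp add: homogeneous_of_degree_def G_def)
  have Gw: "mpol_eval G w = 0"
    unfolding G_def w by (rule eval_rational_point_eq_0[OF rat indep(2)])
  have "mpol_line G u w = 0"
  proof (rule poly_eq_0_if_double_root)
    show "finite (range (to_ac :: 'a \<Rightarrow> _))" "0 \<in> range (to_ac :: 'a \<Rightarrow> _)"
      by (simp, metis rangeI to_ac_0)
    show "poly (pderiv (mpol_line G u w)) 0 = 0"
      using tangent by (simp add: poly_pderiv_mpol_line)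
    show "poly (mpol_line G u w) r = 0" if "r \<in> range (to_ac :: 'a \<Rightarrow> _)" for r
    proof -
      from that obtain a where r: "r = to_ac a" by blast
      have "u + r *s w = (\<chi> i. to_ac ((u0 + a *s w0) $ i))"
        by (simp add: u w r vec_eq_iff)
      then show ?thesis
        using eval_rational_point_eq_0[OF rat indep(1)[of a]] by (simp add: poly_mpol_line G_def)
    qed
    have "degree (mpol_line G u w) \<noteq> d"
    proof
      assume *: "degree (mpol_line G u w) = d"
      then have "lead_coeff (mpol_line G u w) = 0"
        by (simp only: * coeff_mpol_line[OF homG] Gw)
      then have "mpol_line G u w = 0" by simp
      then show False using * d by simp
    qed
    then have "degree (mpol_line G u w) < d"
      using degree_mpol_line[OF homG, of u w] by simp
    moreover have "card (range (to_ac :: 'a \<Rightarrow> _)) = CARD('a)"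
      by (rule card_image) (rule inj_to_ac)
    ultimately show "degree (mpol_line G u w) \<le> card (range (to_ac :: 'a \<Rightarrow> _))"
      using d by simp
  qed
  then have *: "mpol_eval G (u + r *s w) = 0" for r
    by (simp flip: poly_mpol_line)
  show ?thesis
  proof (cases "s = 0")
    case True
    then show ?thesis by (simp add: mpol_eval_scale[OF homG] Gw)
  next
    case False
    then have "s *s u + t *s w = s *s (u + (t / s) *s w)"
      by (simp add: vec_eq_iff algebra_simps)
    then show ?thesis by (simp add: mpol_eval_scale[OF homG] *)
  qed
qed

lemma degree_lower_bound:
  fixes F :: "(3, 'a::{field,finite}) mpol"
  assumes "plane_curve d F" "nonsingular F" and rat: "rational_points \<subseteq> zero_locus F"
  shows "d \<ge> CARD('a) + 2"
proof (rule ccontr)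
  assume "\<not> ?thesis"
  then have d: "d \<le> CARD('a) + 1" by simp
  have d0: "d > 0" and hom: "homogeneous_of_degree d F"
    using assms(1) by (auto simp: plane_curve_def)
  define G where "G = mpol_to_ac F"
  have homG: "homogeneous_of_degree d G"
    using hom by (simp add: homogeneous_of_degree_def G_def)
  let ?g = "\<lambda>l. mpol_eval (mpol_pderiv l G)"
  define u0 :: "'a ^ 3" where "u0 = axis 1 1"
  define u :: "'a alg_closure ^ 3" where "u = (\<chi> i. to_ac (u0 $ i))"
  have "u0 \<noteq> 0" by (auto simp: u0_def vec_eq_iff axis_def)
  then have Gu: "mpol_eval G u = 0"
    unfolding G_def u_def by (rule eval_rational_point_eq_0[OF rat])
  have u_comp: "u $ l = (if l = 1 then 1 else 0)" for l
    by (auto simp: u_def u0_def axis_def)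
  have "u \<noteq> 0" by (auto simp: vec_eq_iff u_comp)
  \<comment> \<open>the ray through \<open>u\<close> consists of zeros of \<open>G\<close>\<close>
  have g1: "?g 1 u = 0"
  proof -
    have "u + t *s u = (1 + t) *s u" for t by (simp add: vec_eq_iff algebra_simps)
    then have "(\<Sum>l\<in>UNIV. u $ l * ?g l u) = 0"
      by (intro directional_derivative_eq_0) (simp add: mpol_eval_scale[OF homG] Gu)
    then show ?thesis by (simp add: u_comp if_distrib[of "\<lambda>x. x * _"] cong: if_cong)
  qed
  obtain i where gi: "?g i u \<noteq> 0"
    using nonsingularD[OF assms(2) hom \<open>u \<noteq> 0\<close>] Gu unfolding G_def by blast
  then have "i \<noteq> 1" using g1 by blast
  have "UNIV = {2, 3, 1 :: 3}" "UNIV = {3, 2, 1 :: 3}"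
    unfolding UNIV_3 by blast+
  moreover have "i = 2 \<or> i = 3"
    using \<open>i \<noteq> 1\<close> exhaust_3[of i] by blast
  moreover have "(2::3) \<noteq> 3" "(2::3) \<noteq> 1" "(3::3) \<noteq> 1" by simp_all
  ultimately obtain j :: 3 where j: "UNIV = {i, j, 1}" "i \<noteq> j" "j \<noteq> 1"
    by metis
  have "d \<ge> 2"
  proof (rule ccontr)
    assume "\<not> d \<ge> 2"
    then have "d = 1" using d0 by simp
    define e :: "'a ^ 3" where "e = axis i 1"
    define h :: "'a alg_closure ^ 3" where "h = (\<chi> i. to_ac (e $ i))"
    have h_comp: "h $ l = (if l = i then 1 else 0)" for l
      by (auto simp: h_def e_def axis_def)
    \<comment> \<open>a linear form has constant partial derivatives: they are its values at the unit vectors\<close>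
    have "e \<noteq> 0" by (auto simp: e_def vec_eq_iff axis_def)
    then have "mpol_eval G h = 0"
      unfolding G_def h_def by (rule eval_rational_point_eq_0[OF rat])
    then have "coeff (mpol_line G u h) 1 = 0"
      using coeff_mpol_line[OF homG] \<open>d = 1\<close> by simp
    then have "poly (pderiv (mpol_line G u h)) 0 = 0"
      by (simp add: poly_0_coeff_0 coeff_pderiv)
    then have "?g i u = 0"
      by (simp add: poly_pderiv_mpol_line h_comp if_distrib[of "\<lambda>x. x * _"] cong: if_cong)
    with gi show False ..
  qed
  define g0 where "g0 l = mpol_eval (mpol_pderiv l F) u0" for l
  have g0: "?g l u = to_ac (g0 l)" for l
    by (simp add: G_def u_def g0_def mpol_pderiv_to_ac mpol_eval_to_ac)
  \<comment> \<open>orthogonal to the gradient \<open>(0, g\<^sub>i, g\<^sub>j)\<close>, hence the direction of the tangent at \<open>u\<close>\<close>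
  define w0 :: "'a ^ 3" where "w0 = (\<chi> l. if l = i then g0 j else if l = j then - g0 i else 0)"
  define w :: "'a alg_closure ^ 3" where "w = (\<chi> i. to_ac (w0 $ i))"
  have "g0 i \<noteq> 0" using gi g0 by auto
  have "mpol_eval G (s *s u + t *s w) = 0" for s t
    unfolding G_def
  proof (rule contains_line_if_tangent[OF hom d0 d rat u_def w_def])
    show "u0 + t *s w0 \<noteq> 0" for t
    proof
      assume "u0 + t *s w0 = 0"
      then have "(u0 + t *s w0) $ 1 = 0" by simp
      then show False using \<open>i \<noteq> 1\<close> j by (auto simp: u0_def w0_def axis_def)
    qed
    show "w0 \<noteq> 0"
    proof
      assume "w0 = 0"
      then have "w0 $ j = 0" by simp
      then show False using j \<open>g0 i \<noteq> 0\<close> by (auto simp: w0_def)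
    qed
    show "(\<Sum>l\<in>UNIV. w $ l * mpol_eval (mpol_pderiv l (mpol_to_ac F)) u) = 0"
      unfolding sum_UNIV_3_distinct[OF j(1,2) \<open>i \<noteq> 1\<close> j(3)]
      using j(2,3) \<open>i \<noteq> 1\<close> g0 by (simp add: w_def w0_def G_def)
  qed
  then have "\<exists>x\<noteq>0. mpol_eval G x = 0 \<and> (\<forall>l. ?g l x = 0)"
    using j \<open>i \<noteq> 1\<close> \<open>g0 i \<noteq> 0\<close>
    by (intro singular_point_if_contains_line[OF homG \<open>d \<ge> 2\<close>, of u w i j 1])
       (auto simp: u_comp w_def w0_def)
  then show False
    using nonsingularD[OF assms(2) hom] unfolding G_def by blast
qed

section \<open>Frobenius and a cubic without rational roots\<close>

lemma power_card_eq_self: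
  fixes x :: "'a::{field,finite}"
  shows "x ^ CARD('a) = x"
proof (cases "x = 0")
  case True
  then show ?thesis by (simp add: power_0_left)
next
  case False
  define U where "U = UNIV - {0 :: 'a}"
  have "bij_betw ((*) x) U U"
    by (rule bij_betw_byWitness[of _ "\<lambda>y. y / x"]) (use False in \<open>auto simp: U_def\<close>)
  then have "(\<Prod>y\<in>U. x * y) = (\<Prod>y\<in>U. y)"
    by (rule prod.reindex_bij_betw)
  moreover have "(\<Prod>y\<in>U. x * y) = x ^ card U * (\<Prod>y\<in>U. y)"
    by (simp only: prod.distrib prod_constant)
  moreover have "(\<Prod>y\<in>U. y) \<noteq> 0"
    by (simp add: U_def)
  ultimately have "x ^ card U = 1" by (metis mult_cancel_right2)
  moreover have "CARD('a) = Suc (card U)"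
    unfolding U_def by (rule card.remove) simp_all
  ultimately show ?thesis by (simp only: power_Suc mult_1_right)
qed

lemma card_eq_CHAR_power:
  assumes "primepow CARD('a::{field,finite})"
  shows "prime CHAR('a) \<and> (\<exists>n. CARD('a) = CHAR('a) ^ n)"
proof -
  obtain p k where p: "prime p" "CARD('a) = p ^ k"
    using assms by (auto simp: primepow_def)
  have "CHAR('a) > 0"
    by (rule finite_imp_CHAR_pos) simp
  then have "prime CHAR('a)" by (rule prime_CHAR_semidom)
  moreover have "CHAR('a) dvd CARD('a)" by (rule CHAR_dvd_CARD)
  ultimately have "CHAR('a) = p"
    using p by (metis prime_dvd_power primes_dvd_imp_eq)
  with p show ?thesis by blast
qed

lemma frobenius_add:
  fixes x y :: "'a::{field,finite} alg_closure"
  assumes "primepow CARD('a)"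
  shows "(x + y) ^ CARD('a) = x ^ CARD('a) + y ^ CARD('a)"
  using card_eq_CHAR_power[OF assms] freshmans_dream'[of "CARD('a)" _ x y] by auto

lemma of_nat_card_eq_0: "of_nat CARD('a::{field,finite}) = (0 :: 'a alg_closure)"
  by (simp add: of_nat_eq_0_iff_char_dvd CHAR_dvd_CARD)

lemma frobenius_minus:
  fixes x :: "'a::{field,finite} alg_closure"
  assumes "primepow CARD('a)"
  shows "(- x) ^ CARD('a) = - (x ^ CARD('a))"
  using frobenius_add[OF assms, of x "- x"] by (simp add: power_0_left eq_neg_iff_add_eq_0 add.commute)

lemma to_ac_frobenius [simp]: "to_ac (z :: 'a::{field,finite}) ^ CARD('a) = to_ac z"
  by (simp add: power_card_eq_self flip: to_ac_power)

text \<open>The \<open>q\<close> rational elements already exhaust the roots of \<open>t\<^sup>q - t\<close>.\<close>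

lemma frobenius_fixed_imp_rational:
  fixes x :: "'a::{field,finite} alg_closure"
  assumes "x ^ CARD('a) = x"
  shows "x \<in> range to_ac"
proof (rule ccontr)
  assume x: "x \<notin> range to_ac"
  let ?q = "CARD('a)"
  define p :: "'a alg_closure poly" where "p = monom 1 ?q + [:0, -1:]"
  have "card {0 :: 'a, 1} \<le> ?q" by (rule card_mono) auto
  then have "?q \<ge> 2" by simp
  then have deg: "degree p = ?q"
    unfolding p_def by (subst degree_add_eq_left) (simp_all add: degree_monom_eq)
  then have "p \<noteq> 0" using \<open>?q \<ge> 2\<close> by auto
  have "insert x (range to_ac) \<subseteq> {t. poly p t = 0}"
    using assms by (auto simp: p_def poly_monom)
  then have "card (insert x (range (to_ac :: 'a \<Rightarrow> _))) \<le> card {t. poly p t = 0}"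
    using poly_roots_finite[OF \<open>p \<noteq> 0\<close>] by (intro card_mono)
  also have "\<dots> \<le> ?q" using card_poly_roots_bound[OF \<open>p \<noteq> 0\<close>] deg by simp
  finally show False using x by (simp add: card_image inj_to_ac)
qed

text \<open>The map \<open>t \<mapsto> t\<^sup>3 - t\<close> takes the same value at \<open>0\<close> and \<open>1\<close>, so on a finite field it is not
  surjective either.\<close>

lemma ex_rootless_cubic: "\<exists>e :: 'a::{field,finite}. \<forall>t. t ^ 3 \<noteq> t + e"
proof -
  have "\<not> inj (\<lambda>t :: 'a. t ^ 3 - t)"
  proof
    assume "inj (\<lambda>t :: 'a. t ^ 3 - t)"
    then have "(0 :: 'a) = 1" by (rule injD) simp
    then show False by simp
  qed
  then have "\<not> surj (\<lambda>t :: 'a. t ^ 3 - t)"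
    using finite_UNIV_surj_inj[of "\<lambda>t :: 'a. t ^ 3 - t"] by auto
  then obtain e where "\<forall>t :: 'a. e \<noteq> t ^ 3 - t" by auto
  then have "t ^ 3 \<noteq> t + e" for t by (metis add_diff_cancel_left')
  then show ?thesis by blast
qed

text \<open>The cubic \<open>t\<^sup>3 - t - k\<close> has no quadratic term, so its roots sum to zero, and two of them
  determine the third.\<close>

lemma third_root_of_cubic:
  fixes a b k :: "'k::field"
  assumes a: "a ^ 3 = a + k" and b: "b ^ 3 = b + k" and "a \<noteq> b"
  defines "c \<equiv> - a - b"
  shows "c ^ 3 = c + k" "a * b + b * c + c * a = -1" "a * b * c = k"
    and "d ^ 3 = d + k \<Longrightarrow> d = a \<or> d = b \<or> d = c"
proof -
  have "(a - b) * (a\<^sup>2 + a * b + b\<^sup>2 - 1) = 0" using a b by Groebner_Basis.algebra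
  then have quad: "a\<^sup>2 + a * b + b\<^sup>2 = 1" using \<open>a \<noteq> b\<close> by simp
  show "c ^ 3 = c + k" "a * b + b * c + c * a = -1" "a * b * c = k"
    unfolding c_def using a quad by Groebner_Basis.algebra+
  assume "d ^ 3 = d + k"
  then have "(d - a) * (d - b) * (d - c) = 0"
    unfolding c_def using a quad by Groebner_Basis.algebra
  then show "d = a \<or> d = b \<or> d = c" by simp
qed

text \<open>Frobenius permutes the roots of \<open>t\<^sup>3 - t - e\<close> without fixed points, because a fixed root would
  be rational. It cannot swap two of them either, for then it would fix the third. So it is a
  cyclic permutation of three distinct roots.\<close>

lemma conjugate_roots:
  fixes e :: "'a::{field,finite}"
  assumes pp: "primepow CARD('a)" and e: "\<forall>t. t ^ 3 \<noteq> t + e"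
  obtains a b c :: "'a alg_closure"
  where "b = a ^ CARD('a)" "c = b ^ CARD('a)" "a = c ^ CARD('a)"
    "a \<noteq> b" "b \<noteq> c" "c \<noteq> a"
    "a + b + c = 0" "a * b + b * c + c * a = -1" "a * b * c = to_ac e"
proof -
  define fr :: "'a alg_closure \<Rightarrow> 'a alg_closure" where "fr x = x ^ CARD('a)" for x
  have fr_add: "fr (x + y) = fr x + fr y" and fr_minus: "fr (- x) = - fr x"
    and fr_mult: "fr (x * y) = fr x * fr y" and fr_pow: "fr (x ^ n) = fr x ^ n"
    and fr_0: "fr 0 = 0" for x y n
    by (simp_all add: fr_def frobenius_add[OF pp] frobenius_minus[OF pp] power_mult_distrib
        power_0_left flip: power_mult) (simp add: mult.commute)
  have fr_e: "fr (to_ac e) = to_ac e" by (simp add: fr_def)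
  have fr_inj: "x = y" if "fr x = fr y" for x y
  proof -
    have "fr (x + (- y)) = 0" using that by (simp only: fr_add fr_minus) simp
    then show ?thesis by (simp add: fr_def)
  qed
  have fixed_not_root: False if fx: "fr x = x" and rx: "x ^ 3 = x + to_ac e" for x
  proof -
    obtain t where t: "x = to_ac t"
      using frobenius_fixed_imp_rational fx unfolding fr_def by blast
    have "to_ac (t ^ 3) = to_ac (t + e)" using rx by (simp add: t)
    then show False using e unfolding to_ac_eq_iff by blast
  qed
  have "degree [:- to_ac e, -1, 0, 1:] > 0" by simp
  from alg_closed_imp_poly_has_root[OF this]
  obtain a where "poly [:- to_ac e, -1, 0, 1:] a = 0" by blast
  then have a: "a ^ 3 = a + to_ac e" by (simp add: algebra_simps power3_eq_cube)
  define b where "b = fr a"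
  define c where "c = - a - b"
  have b: "b ^ 3 = b + to_ac e"
    unfolding b_def by (simp add: a fr_add fr_e flip: fr_pow)
  have "a \<noteq> b" using fixed_not_root a unfolding b_def by metis
  note c = third_root_of_cubic[OF a b \<open>a \<noteq> b\<close>, folded c_def]
  have fr_b: "fr b = c"
  proof -
    have "fr b ^ 3 = fr b + to_ac e"
      by (simp add: b fr_add fr_e flip: fr_pow)
    then have "fr b = a \<or> fr b = b \<or> fr b = c" by (rule c(4))
    moreover have "fr b \<noteq> b" using fixed_not_root b by metis
    moreover have "fr b \<noteq> a"
    proof
      assume "fr b = a"
      then have "fr c = c" by (simp add: c_def fr_add[of "- a" "- b", simplified] fr_minus b_def[symmetric])
      then show False using fixed_not_root c(1) by metis
    qed
    ultimately show ?thesis by simp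
  qed
  have "fr (a + b + c) = 0" by (simp add: c_def fr_0)
  then have "b + c + fr c = 0" by (simp add: fr_add fr_b flip: b_def)
  then have fr_c: "fr c = a" by (simp add: c_def)
  show thesis
  proof (rule that[of b a c])
    show "b = a ^ CARD('a)" "c = b ^ CARD('a)" "a = c ^ CARD('a)"
      using b_def fr_b fr_c by (simp_all add: fr_def)
    show "a \<noteq> b" by fact
    show "b \<noteq> c" using fixed_not_root b fr_b by metis
    show "c \<noteq> a" using fixed_not_root a fr_c by metis
    show "a + b + c = 0" by (simp add: c_def)
    show "a * b + b * c + c * a = -1" by (rule c(2))
    show "a * b * c = to_ac e" by (rule c(3))
  qed
qed


section \<open>The form det (M x, x, x^q)\<close>

definition mono3 :: "nat \<Rightarrow> nat \<Rightarrow> nat \<Rightarrow> 'a::comm_semiring_1 \<Rightarrow> (3, 'a) mpol" where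
  "mono3 i j k c = single (single 1 i + single 2 j + single 3 k) c"

lemma prod_UNIV_3: "prod f (UNIV :: 3 set) = f 1 * f 2 * f 3"
  unfolding UNIV_3 by (simp add: ac_simps)

lemma lookup_exponents:
  "lookup (single (1::3) i + single 2 j + single 3 k) l = (if l = 1 then i else if l = 2 then j else (k::nat))"
  using exhaust_3[of l] by (auto simp: lookup_add lookup_single)

lemma mpol_eval_mono3: "mpol_eval (mono3 i j k c) v = c * (v $ 1 ^ i * v $ 2 ^ j * v $ 3 ^ k)"
  by (simp only: mono3_def mpol_eval_single prod_UNIV_3 lookup_exponents) simp

lemma mpol_pderiv_mono3:
  "mpol_pderiv 1 (mono3 i j k c) = mono3 (i - 1) j k (of_nat i * c)"
  "mpol_pderiv 2 (mono3 i j k c) = mono3 i (j - 1) k (of_nat j * c)"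
  "mpol_pderiv 3 (mono3 i j k c) = mono3 i j (k - 1) (of_nat k * c)"
proof -
  have "single 1 i + single 2 j + single 3 k - single (1::3) 1 = single 1 (i - 1) + single 2 j + single 3 k"
    "single 1 i + single 2 j + single 3 k - single (2::3) 1 = single 1 i + single 2 (j - 1) + single 3 k"
    "single 1 i + single 2 j + single 3 k - single (3::3) 1 = single 1 i + single 2 j + single 3 (k - 1)"
    using exhaust_3
    by (intro poly_mapping_eqI; force simp: lookup_minus lookup_exponents lookup_single when_def)+
  then show
    "mpol_pderiv 1 (mono3 i j k c) = mono3 (i - 1) j k (of_nat i * c)"
    "mpol_pderiv 2 (mono3 i j k c) = mono3 i (j - 1) k (of_nat j * c)"
    "mpol_pderiv 3 (mono3 i j k c) = mono3 i j (k - 1) (of_nat k * c)"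
    by (simp_all add: mono3_def lookup_exponents)
qed

lemma mpol_to_ac_mono3: "mpol_to_ac (mono3 i j k c) = mono3 i j k (to_ac c)"
  by (simp add: mono3_def)

lemma homogeneous_of_degree_mono3: "i + j + k = d \<Longrightarrow> homogeneous_of_degree d (mono3 i j k c)"
  by (simp add: homogeneous_of_degree_def mono3_def lookup_exponents sum_3)

lemma homogeneous_of_degree_add:
  "homogeneous_of_degree d F \<Longrightarrow> homogeneous_of_degree d G \<Longrightarrow> homogeneous_of_degree d (F + G)"
  unfolding homogeneous_of_degree_def using keys_add[of F G] by blast

text \<open>The determinant of the rows \<open>(e x\<^sub>3, x\<^sub>1 + x\<^sub>3, x\<^sub>2)\<close>, \<open>(x\<^sub>1, x\<^sub>2, x\<^sub>3)\<close> and
  \<open>(x\<^sub>1\<^sup>q, x\<^sub>2\<^sup>q, x\<^sub>3\<^sup>q)\<close>, expanded. The first row is the product of \<open>x\<^sub>1 + x\<^sub>2 \<theta> + x\<^sub>3 \<theta>\<^sup>2\<close> with \<open>\<theta>\<close>,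
  where \<open>\<theta>\<^sup>3 = \<theta> + e\<close>.\<close>

definition frobenius_form :: "nat \<Rightarrow> 'a::comm_ring_1 \<Rightarrow> (3, 'a) mpol" where
  "frobenius_form q e =
     mono3 (q + 1) 0 1 1 + mono3 q 0 2 1 + mono3 q 2 0 (- 1)
     + mono3 1 (q + 1) 0 1 + mono3 0 q 2 (- e)
     + mono3 0 1 (q + 1) e + mono3 2 0 q (- 1) + mono3 1 0 (q + 1) (- 1)"

lemma mpol_to_ac_frobenius_form: "mpol_to_ac (frobenius_form q e) = frobenius_form q (to_ac e)"
  by (simp add: frobenius_form_def mpol_to_ac_add mpol_to_ac_mono3)

lemma homogeneous_frobenius_form: "homogeneous_of_degree (q + 2) (frobenius_form q e)"
  unfolding frobenius_form_def
  by (intro homogeneous_of_degree_add homogeneous_of_degree_mono3) auto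

text \<open>The same determinant with an arbitrary third row \<open>y\<close>. In characteristic dividing \<open>q\<close> the vector
  \<open>x\<^sup>q\<close> behaves like a constant under differentiation, so for the algebra \<open>x\<close> and \<open>y\<close> can be
  treated as independent.\<close>

definition theta_det :: "'k::comm_ring_1 \<Rightarrow> 'k \<Rightarrow> 'k \<Rightarrow> 'k \<Rightarrow> 'k \<Rightarrow> 'k \<Rightarrow> 'k \<Rightarrow> 'k" where
  "theta_det e x1 x2 x3 y1 y2 y3 =
     y1 * ((x1 + x3) * x3 - x2 * x2) + y2 * (x2 * x1 - e * x3 * x3) + y3 * (e * x3 * x2 - (x1 + x3) * x1)"

lemma mpol_eval_frobenius_form:
  "mpol_eval (frobenius_form q e) v =
     theta_det e (v $ 1) (v $ 2) (v $ 3) (v $ 1 ^ q) (v $ 2 ^ q) (v $ 3 ^ q)"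
  by (simp add: frobenius_form_def theta_det_def mpol_eval_add mpol_eval_mono3 power2_eq_square algebra_simps)

text \<open>These are the derivatives of \<open>theta_det\<close> with respect to \<open>x\<close> with the third row held fixed.\<close>

lemma mpol_pderiv_frobenius_form:
  fixes v :: "'k::comm_ring_1 ^ 3"
  assumes "of_nat q = (0 :: 'k)"
  defines "y \<equiv> \<lambda>i. v $ i ^ q"
  shows "mpol_eval (mpol_pderiv 1 (frobenius_form q e)) v =
      y 1 * v $ 3 + y 2 * v $ 2 - 2 * y 3 * v $ 1 - y 3 * v $ 3"
    and "mpol_eval (mpol_pderiv 2 (frobenius_form q e)) v =
      - 2 * y 1 * v $ 2 + y 2 * v $ 1 + e * y 3 * v $ 3"
    and "mpol_eval (mpol_pderiv 3 (frobenius_form q e)) v =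
      y 1 * v $ 1 + 2 * y 1 * v $ 3 - 2 * e * y 2 * v $ 3 + e * y 3 * v $ 2 - y 3 * v $ 1"
  by (simp_all add: frobenius_form_def mpol_pderiv_add mpol_eval_add mpol_pderiv_mono3
      mpol_eval_mono3 assms(1) y_def algebra_simps)


section \<open>Diagonalization and nonsingularity\<close>

text \<open>If \<open>a, b, c\<close> are the roots of \<open>t\<^sup>3 - t - e\<close>, the linear forms \<open>\<xi>\<close> at \<open>a, b, c\<close> are
  eigenvectors for multiplication by \<open>\<theta>\<close>. Passing to them multiplies the determinant by the
  Vandermonde determinant of \<open>a, b, c\<close> and makes its first row \<open>(a \<xi> a, b \<xi> b, c \<xi> c)\<close>.\<close>

lemma theta_det_diagonalized:
  fixes a b c x1 x2 x3 y1 y2 y3 :: "'k::field"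
  assumes "a + b + c = 0" "a * b + b * c + c * a = -1" "a * b * c = e"
  defines "\<xi> \<equiv> \<lambda>t. x1 + t * x2 + t * t * x3" and "\<eta> \<equiv> \<lambda>t. y1 + t * y2 + t * t * y3"
  shows "(b - a) * (c - a) * (c - b) * theta_det e x1 x2 x3 y1 y2 y3 =
    (b - c) * \<xi> b * \<xi> c * \<eta> a + (c - a) * \<xi> c * \<xi> a * \<eta> b + (a - b) * \<xi> a * \<xi> b * \<eta> c"
  unfolding \<xi>_def \<eta>_def theta_det_def
  using assms(1-3) by Groebner_Basis.algebra

text \<open>The left side is the derivative with respect to \<open>\<xi> a\<close> of the diagonalized determinant. By
  the chain rule it is a combination of the derivatives with respect to the \<open>x\<^sub>i\<close>, with coefficients
  proportional to those of \<open>(t - b) (t - c)\<close>, because the dual basis of the \<open>\<xi>\<close> is given by Lagrange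
  interpolation. By cyclic symmetry it covers all three coordinates.\<close>

lemma gradient_diagonalized:
  fixes a b c x1 x2 x3 y1 y2 y3 :: "'k::field"
  assumes "a + b + c = 0" "a * b + b * c + c * a = -1" "a * b * c = e"
  defines "\<xi> \<equiv> \<lambda>t. x1 + t * x2 + t * t * x3" and "\<eta> \<equiv> \<lambda>t. y1 + t * y2 + t * t * y3"
  shows "(c - a) * \<xi> c * \<eta> b + (a - b) * \<xi> b * \<eta> c = (c - b) *
    (b * c * (y1 * x3 + y2 * x2 - 2 * y3 * x1 - y3 * x3)
     - (b + c) * (- 2 * y1 * x2 + y2 * x1 + e * y3 * x3)
     + (y1 * x1 + 2 * y1 * x3 - 2 * e * y2 * x3 + e * y3 * x2 - y3 * x1))"
  unfolding \<xi>_def \<eta>_def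
  using assms(1-3) by Groebner_Basis.algebra

text \<open>The hypotheses are that the partial derivatives of \<open>A x y\<^sup>q\<^sup>+\<^sup>1 + B y z\<^sup>q\<^sup>+\<^sup>1 + C z x\<^sup>q\<^sup>+\<^sup>1\<close> vanish (the
  characteristic dividing \<open>q\<close>) together with the form itself. Multiplied by \<open>x\<close> and \<open>y\<close>, the first
  two say that two pairs among the three terms cancel. As all three terms also cancel, the first
  is zero, so a coordinate vanishes, and then the partial derivatives kill the others
  in turn. The equation of the curve is needed here because in characteristic \<open>2\<close> the three
  pairwise cancellations do not imply that the terms are zero.\<close>

lemma cyclic_curve_nonsingular:
  fixes A B C x y z :: "'k::field"
  assumes nz: "A \<noteq> 0" "B \<noteq> 0" "C \<noteq> 0" and "q > 0"
    and gx: "C * z * x ^ q + A * y ^ (q + 1) = 0"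
    and gy: "A * x * y ^ q + B * z ^ (q + 1) = 0"
    and gz: "B * y * z ^ q + C * x ^ (q + 1) = 0"
    and F: "A * x * y ^ (q + 1) + B * y * z ^ (q + 1) + C * z * x ^ (q + 1) = 0"
  shows "x = 0 \<and> y = 0 \<and> z = 0"
proof -
  have "A * x * y ^ (q + 1) = 0"
  proof -
    have "C * z * x ^ (q + 1) + A * x * y ^ (q + 1) = x * (C * z * x ^ q + A * y ^ (q + 1))"
      "A * x * y ^ (q + 1) + B * y * z ^ (q + 1) = y * (A * x * y ^ q + B * z ^ (q + 1))"
      by (simp_all add: algebra_simps)
    then have "C * z * x ^ (q + 1) + A * x * y ^ (q + 1) = 0" "A * x * y ^ (q + 1) + B * y * z ^ (q + 1) = 0"
      using gx gy by simp_all
    moreover have "P = 0" if "R + P = 0" "P + Q = 0" "P + Q + R = 0" for P Q R :: 'k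
      using that by simp
    ultimately show ?thesis using F by blast
  qed
  then have "x = 0 \<or> y = 0" using nz by auto
  then show ?thesis
    using gx gy gz nz \<open>q > 0\<close> by (auto simp: power_0_left)
qed

lemma nonsingular_frobenius_form:
  fixes e :: "'a::{field,finite}"
  assumes pp: "primepow CARD('a)" and e: "\<forall>t. t ^ 3 \<noteq> t + e"
    and "v \<noteq> 0" and F: "mpol_eval (frobenius_form CARD('a) (to_ac e)) v = 0"
  shows "\<exists>i. mpol_eval (mpol_pderiv i (frobenius_form CARD('a) (to_ac e))) v \<noteq> 0"
proof (rule ccontr)
  assume "\<not> ?thesis"
  then have grad: "mpol_eval (mpol_pderiv i (frobenius_form CARD('a) (to_ac e))) v = 0" for i
    by blast
  let ?q = "CARD('a)"
  obtain a b c where conj: "b = a ^ ?q" "c = b ^ ?q" "a = c ^ ?q"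
    and neq: "a \<noteq> b" "b \<noteq> c" "c \<noteq> a"
    and sym: "a + b + c = 0" "a * b + b * c + c * a = -1" "a * b * c = to_ac e"
    using conjugate_roots[OF pp e] by metis
  define \<xi> where "\<xi> t = v $ 1 + t * v $ 2 + t * t * v $ 3" for t
  define \<eta> where "\<eta> t = v $ 1 ^ ?q + t * v $ 2 ^ ?q + t * t * v $ 3 ^ ?q" for t
  have frob: "\<eta> (t ^ ?q) = \<xi> t ^ ?q" for t
    by (simp add: \<xi>_def \<eta>_def frobenius_add[OF pp] power_mult_distrib)
  then have \<eta>b: "\<eta> b = \<xi> a ^ ?q" and \<eta>c: "\<eta> c = \<xi> b ^ ?q" and \<eta>a: "\<eta> a = \<xi> c ^ ?q"
    using frob[of a] frob[of b] frob[of c] by (simp_all flip: conj)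
  note partials = grad[of 1, unfolded mpol_pderiv_frobenius_form(1)[OF of_nat_card_eq_0]]
    grad[of 2, unfolded mpol_pderiv_frobenius_form(2)[OF of_nat_card_eq_0]]
    grad[of 3, unfolded mpol_pderiv_frobenius_form(3)[OF of_nat_card_eq_0]]
  \<comment> \<open>stated for arbitrary names of the roots, to be used for the three cyclic shifts\<close>
  have G: "(c' - a') * \<xi> c' * \<eta> b' + (a' - b') * \<xi> b' * \<eta> c' = 0"
    if "a' + b' + c' = 0" "a' * b' + b' * c' + c' * a' = -1" "a' * b' * c' = to_ac e" for a' b' c'
    unfolding \<xi>_def \<eta>_def gradient_diagonalized[OF that] partials by simp
  have "\<xi> a = 0 \<and> \<xi> b = 0 \<and> \<xi> c = 0"
  proof (rule cyclic_curve_nonsingular)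
    show "a - b \<noteq> 0" "b - c \<noteq> 0" "c - a \<noteq> 0" "?q > 0" using neq by auto
    show "(c - a) * \<xi> c * \<xi> a ^ ?q + (a - b) * \<xi> b ^ (?q + 1) = 0"
      using G[OF sym] by (simp add: \<eta>b \<eta>c mult_ac)
    show "(a - b) * \<xi> a * \<xi> b ^ ?q + (b - c) * \<xi> c ^ (?q + 1) = 0"
      using G[of b c a] sym by (simp add: \<eta>a \<eta>c algebra_simps)
    show "(b - c) * \<xi> b * \<xi> c ^ ?q + (c - a) * \<xi> a ^ (?q + 1) = 0"
      using G[of c a b] sym by (simp add: \<eta>a \<eta>b algebra_simps)
    have "(b - c) * \<xi> b * \<xi> c * \<eta> a + (c - a) * \<xi> c * \<xi> a * \<eta> b + (a - b) * \<xi> a * \<xi> b * \<eta> c = 0"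
      using theta_det_diagonalized[OF sym, of "v $ 1" "v $ 2" "v $ 3" "v $ 1 ^ ?q" "v $ 2 ^ ?q" "v $ 3 ^ ?q"] F
      by (simp add: mpol_eval_frobenius_form \<xi>_def \<eta>_def)
    then show "(a - b) * \<xi> a * \<xi> b ^ (?q + 1) + (b - c) * \<xi> b * \<xi> c ^ (?q + 1)
        + (c - a) * \<xi> c * \<xi> a ^ (?q + 1) = 0"
      by (simp add: \<eta>a \<eta>b \<eta>c mult_ac add_ac)
  qed
  \<comment> \<open>a quadratic polynomial with the three distinct roots \<open>a, b, c\<close> has zero coefficients\<close>
  then have "v $ 1 + a * v $ 2 + a * a * v $ 3 = 0" "v $ 1 + b * v $ 2 + b * b * v $ 3 = 0"
    "v $ 1 + c * v $ 2 + c * c * v $ 3 = 0" by (simp_all add: \<xi>_def)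
  then have "(a - b) * (b - c) * (c - a) * v $ 3 = 0" "(a - b) * (b - c) * (c - a) * v $ 2 = 0"
    "(a - b) * (b - c) * (c - a) * v $ 1 = 0" by Groebner_Basis.algebra+
  then have "v = 0" using neq by (simp add: vec_eq_iff forall_3)
  with \<open>v \<noteq> 0\<close> show False ..
qed

lemma ex_nonsingular_filling_curve:
  assumes pp: "primepow CARD('a::{field,finite})"
  shows "\<exists>F :: (3, 'a) mpol.
    plane_curve (CARD('a) + 2) F \<and> nonsingular F \<and> rational_points \<subseteq> zero_locus F"
proof -
  obtain e :: 'a where e: "\<forall>t. t ^ 3 \<noteq> t + e" using ex_rootless_cubic by blast
  define F where "F = frobenius_form CARD('a) e"
  have G: "mpol_to_ac F = frobenius_form CARD('a) (to_ac e)"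
    by (simp add: F_def mpol_to_ac_frobenius_form)
  have rat: "rational_points \<subseteq> zero_locus F"
  proof
    fix P :: "('a alg_closure ^ 3) set"
    assume "P \<in> rational_points"
    then obtain v :: "'a ^ 3" where v: "v \<noteq> 0" "P = proj_point (\<chi> i. to_ac (v $ i))"
      unfolding rational_points_def by blast
    \<comment> \<open>the second and third row of the determinant are proportional\<close>
    have "mpol_eval (mpol_to_ac F) (k *s (\<chi> i. to_ac (v $ i))) = 0" for k
      by (simp add: G mpol_eval_frobenius_form theta_det_def power_mult_distrib algebra_simps)
    moreover have "(\<chi> i. to_ac (v $ i)) \<noteq> 0"
      using v(1) by (auto simp: vec_eq_iff)
    ultimately show "P \<in> zero_locus F"
      unfolding v(2) zero_locus_def proj_plane_def proj_point_def by auto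
  qed
  have ns: "nonsingular F"
    unfolding nonsingular_def G
  proof (intro ballI)
    fix P v assume P: "P \<in> zero_locus F" "v \<in> P"
    then have "v \<noteq> 0" by (auto simp: zero_locus_def proj_plane_def proj_point_def)
    moreover have "mpol_eval (frobenius_form CARD('a) (to_ac e)) v = 0"
      using P by (auto simp: zero_locus_def G)
    ultimately show "\<exists>i. mpol_eval (mpol_pderiv i (frobenius_form CARD('a) (to_ac e))) v \<noteq> 0"
      using nonsingular_frobenius_form[OF pp e] by blast
  qed
  have hom: "homogeneous_of_degree (CARD('a) + 2) F"
    unfolding F_def by (rule homogeneous_frobenius_form)
  have "F \<noteq> 0"
  proof
    assume "F = 0"
    moreover have "axis 1 1 \<noteq> (0 :: 'a alg_closure ^ 3)" by (simp add: axis_eq_0_iff)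
    ultimately show False
      using nonsingularD[OF ns hom] by (fastforce simp: mpol_pderiv_def)
  qed
  then have "plane_curve (CARD('a) + 2) F"
    using hom unfolding plane_curve_def by (metis add_gr_0 zero_less_numeral)
  with ns rat show ?thesis by blast
qed

theorem corollary3p3:
  fixes q :: nat
  assumes "primepow q"
    and "CARD('a::{field, finite}) = q"
  shows "(\<forall>d (F :: (3, 'a) mpol).
            plane_curve d F \<and> nonsingular F \<and> rational_points \<subseteq> zero_locus F \<longrightarrow> d \<ge> q + 2)
       \<and> (\<exists>F :: (3, 'a) mpol.
            plane_curve (q + 2) F \<and> nonsingular F \<and> rational_points \<subseteq> zero_locus F)"
  using degree_lower_bound ex_nonsingular_filling_curve assms by blast

end
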